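(* Let $n\ge 1$ and let $\pi\in S_n$. If $\pi$ is a unimodal cycle of $[n]=\{1,\dots,n\}$, then the inversion graph $G_\pi$ is a caterpillar.
   Context: Inversion graph: $G_\pi$ is the simple graph with vertex set $[n]$ (the values of $\pi$) in which values $a<b$ are adjacent if and only if $b$ appears to the left of $a$ in the one-line notation $\pi(1)\cdots\pi(n)$, i.e. $\pi^{-1}(b)<\pi^{-1}(a)$. Unimodal cycle: $\pi$ is a unimodal cycle of $[n]$ if it can be written as a single cycle $(c_1,\dots,c_n)$ on all of $[n]$ (mapping $c_i\mapsto c_{i+1}$, indices cyclic) whose entries, after cyclic rotation, strictly increase to a maximum and then strictly decrease. Equivalently, for $n\ge 2$, the cycle has the form $(u_1,\dots,u_r,n,d_1,\dots,d_s,1)$ with $u_1<\cdots<u_r<n$ and $n>d_1>\cdots>d_s>1$, where $r=0$ and $s=0$ are allowed; for $n=1$ the singleton cycle $(1)$ is a unimodal cycle. Caterpillar: a tree in which every nonleaf vertex lies on a single path, called the spine; equivalently, a tree such that removing all leaves yields a path (possibly empty or a single vertex). *)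

theory Defs
  imports "HOL-Combinatorics.Cycles" "Graph_Theory.Graph_Theory"
begin

text \<open>
  Finite simple graphs are symmetric loop-free digraphs without parallel arcs
  (\<^locale>\<open>pair_graph\<close>): an edge between \<open>a\<close> and \<open>b\<close> is the pair of arcs \<open>(a, b)\<close>, \<open>(b, a)\<close>.
\<close>

definition inversion_graph :: "nat \<Rightarrow> (nat \<Rightarrow> nat) \<Rightarrow> nat pair_pre_digraph" where
  "inversion_graph n \<pi> =
     \<lparr> pverts = {1..n},
       parcs = {(a, b). a \<in> {1..n} \<and> b \<in> {1..n} \<and>
                  (a < b \<and> inv \<pi> b < inv \<pi> a \<or> b < a \<and> inv \<pi> a < inv \<pi> b)} \<rparr>"

definition unimodal :: "nat list \<Rightarrow> bool" where
  "unimodal cs \<longleftrightarrow>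
     (\<exists>us m ds. cs = us @ m # ds \<and> sorted_wrt (<) (us @ [m]) \<and> sorted_wrt (>) (m # ds))"

text \<open>\<^const>\<open>cycle_of_list\<close> maps each entry of a distinct list to the next one, cyclically.\<close>

definition unimodal_cycle :: "nat \<Rightarrow> (nat \<Rightarrow> nat) \<Rightarrow> bool" where
  "unimodal_cycle n \<pi> \<longleftrightarrow>
     (\<exists>cs. distinct cs \<and> set cs = {1..n} \<and> \<pi> = cycle_of_list cs \<and> (\<exists>k. unimodal (rotate k cs)))"

text \<open>
  The library's \<^const>\<open>tree\<close> is meant for orientations of a graph: in a symmetric digraph it
  counts \<open>a, b, a\<close> as a cycle. Undirected cycles are the directed ones with at least three arcs.
\<close>

definition undirected_tree :: "'a pair_pre_digraph \<Rightarrow> bool" where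
  "undirected_tree G \<longleftrightarrow>
     pair_graph G \<and> Digraph_Component.connected (with_proj G) \<and>
     \<not> (\<exists>p. pre_digraph.cycle (with_proj G) p \<and> 3 \<le> length p)"

text \<open>In a symmetric digraph the out-degree is the number of neighbours.\<close>

definition leaf :: "'a pair_pre_digraph \<Rightarrow> 'a \<Rightarrow> bool" where
  "leaf G v \<longleftrightarrow> v \<in> pverts G \<and> out_degree (with_proj G) v = 1"

definition caterpillar :: "'a pair_pre_digraph \<Rightarrow> bool" where
  "caterpillar G \<longleftrightarrow>
     undirected_tree G \<and> (\<exists>p. vpath p (with_proj G) \<and> {v \<in> pverts G. \<not> leaf G v} \<subseteq> set p)"

end

theory Submission
  imports Defs
begin

text \<open>
  Let \<open>n \<ge> 2\<close>, and call a position \<open>a\<close> an ascent if \<open>a < \<pi> a\<close>. In a unimodal cycle the entries from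
  the minimum \<open>1\<close> up to just before the maximum \<open>n\<close> are the ascents, and \<open>\<pi>\<close> takes each of them to
  the next larger ascent or to \<open>n\<close>; every other position goes to the next smaller non-ascent
  or to \<open>1\<close> (\<open>unimodal_cycle_laced\<close>). So the intervals \<open>[a, \<pi> a]\<close> of the ascents tile
  \<open>[1, n]\<close>, and so do the intervals \<open>[\<pi> d, d]\<close> of the other positions; apart from \<open>1\<close> and \<open>n\<close>, each
  integer is an end point in exactly one of the two tilings. Two values form an inversion iff they
  belong to intervals of different tilings whose interiors meet.

  Read from left to right. Passing each integer \<open>j < n\<close> opens exactly one new interval (for
  \<open>j = 1\<close> one in each tiling), and the new interval meets exactly one of the intervals that were
  opened before: the current one of the other tiling. Hence \<open>G\<^sub>\<pi>\<close> arises from one vertex by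
  attaching one vertex after the other, each with a single edge to an older one, so it is a tree.
  Moreover, two consecutive new vertices are either attached to the same vertex, or the second is
  attached to the first, according to whether they open intervals of the same tiling or not.
  So the vertices to which something is attached, in the order of their use, form a path, and
  any vertex off this path keeps the degree \<open>1\<close> that it had when it was attached.

  The two halves of this argument are separated. The locale \<open>recursive_tree\<close> treats graphs
  that arise by attaching vertices, and proves that they are trees, and caterpillars under the
  stated condition on consecutive attachments. The locale \<open>laced_permutation\<close> derives this
  structure for \<open>G\<^sub>\<pi>\<close> from the two tilings.
\<close>

section \<open>Trees grown by attaching one vertex at a time\<close>

text \<open>
  The vertex \<open>w j\<close> is attached at time \<open>j\<close> to the older vertex \<open>w (q j)\<close>. The root is \<open>w 0\<close>, so
  the value \<open>q 0\<close> has no meaning.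
\<close>

locale recursive_tree =
  fixes G :: "'a pair_pre_digraph" and w :: "nat \<Rightarrow> 'a" and q :: "nat \<Rightarrow> nat" and n :: nat
  assumes n_pos: "0 < n"
    and bij_w: "bij_betw w {..<n} (pverts G)"
    and parent_less: "0 < j \<Longrightarrow> j < n \<Longrightarrow> q j < j"
    and parcs_eq: "parcs G = (\<Union>j\<in>{0<..<n}. {(w j, w (q j)), (w (q j), w j)})"
begin

lemma pverts_eq: "pverts G = w ` {..<n}"
  using bij_w by (simp add: bij_betw_def)

lemma w_eq_iff: "i < n \<Longrightarrow> j < n \<Longrightarrow> w i = w j \<longleftrightarrow> i = j"
  using bij_w by (auto simp: bij_betw_def inj_on_def)

lemma arc_iff:
  assumes "i < n" "j < n"
  shows "(w i, w j) \<in> parcs G \<longleftrightarrow> 0 < i \<and> j = q i \<or> 0 < j \<and> i = q j"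
proof -
  have "q k < n" if k: "0 < k" "k < n" for k
    using parent_less[OF k] k by simp
  then show ?thesis
    using assms by (auto simp: parcs_eq w_eq_iff)
qed

lemma arcE:
  assumes "(x, y) \<in> parcs G"
  obtains i j where "i < n" "j < n" "x = w i" "y = w j" "0 < i \<and> j = q i \<or> 0 < j \<and> i = q j"
proof -
  obtain k where k: "0 < k" "k < n" "x = w k \<and> y = w (q k) \<or> x = w (q k) \<and> y = w k"
    using assms by (auto simp: parcs_eq)
  moreover have "q k < n"
    using k parent_less[of k] by auto
  ultimately show thesis
    using that by blast
qed

lemma pair_graph: "pair_graph G"
proof (unfold_locales)
  show "fst e \<in> pverts G" "snd e \<in> pverts G" if "e \<in> parcs G" for e
    using that by (cases e; auto simp: pverts_eq elim: arcE)+
  show "finite (pverts G)" "finite (parcs G)"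
    by (auto simp: pverts_eq parcs_eq)
  show "fst e \<noteq> snd e" if e: "e \<in> parcs G" for e
  proof
    assume "fst e = snd e"
    then obtain i j where "i < n" "j < n" "w i = w j" "0 < i \<and> j = q i \<or> 0 < j \<and> i = q j"
      using arcE[of "fst e" "snd e"] e unfolding prod.collapse by metis
    then have "0 < i" "i < n" "q i = i"
      using w_eq_iff by auto
    then show False
      using parent_less[of i] by simp
  qed
  show "symmetric (with_proj G)"
    by (auto simp: symmetric_def sym_def parcs_eq)
qed

lemma connected: "Digraph_Component.connected (with_proj G)"
proof -
  interpret pair_graph G by (rule pair_graph)
  have root: "w 0 \<rightarrow>\<^sup>*\<^bsub>G\<^esub> w j" if "j < n" for j
    using that
  proof (induction j rule: less_induct)
    case (less j)
    show ?case
    proof (cases "j = 0")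
      case True
      then show ?thesis
        using n_pos by (auto simp: pverts_eq)
    next
      case False
      then have "q j < j"
        using parent_less[of j] less.prems by simp
      moreover from this have "(w (q j), w j) \<in> parcs G"
        using less.prems False by (auto simp: arc_iff)
      ultimately show ?thesis
        using less reachable_adj_trans[of "w 0" "w (q j)" "w j"] by simp
    qed
  qed
  have "u \<rightarrow>\<^sup>*\<^bsub>G\<^esub> v" if "u \<in> pverts G" "v \<in> pverts G" for u v
  proof -
    have "w 0 \<rightarrow>\<^sup>*\<^bsub>G\<^esub> u" "w 0 \<rightarrow>\<^sup>*\<^bsub>G\<^esub> v"
      using that root by (auto simp: pverts_eq)
    then show ?thesis
      using symmetric_reachable'[of "w 0" u] reachable_trans[of u "w 0" v] by simp
  qed
  then have "u \<rightarrow>\<^sup>*\<^bsub>mk_symmetric G\<^esub> v" if "u \<in> pverts G" "v \<in> pverts G" for u v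
    using that reachable_mk_symmetricI by blast
  moreover have "pverts G \<noteq> {}"
    using n_pos by (auto simp: pverts_eq)
  ultimately show ?thesis
    by (auto simp: connected_def intro!: strongly_connectedI)
qed

end

lemma pawalk_verts_eq_heads: "pcas u p v \<Longrightarrow> pawalk_verts u p = u # map snd p"
  by (induction p arbitrary: u) auto

lemma pcas_append: "pcas u (p @ p') v \<longleftrightarrow> (\<exists>x. pcas u p x \<and> pcas x p' v)"
  by (induction p arbitrary: u) auto

context recursive_tree
begin

text \<open>
  Start a cycle at its youngest vertex. The next and the previous vertex are both older
  neighbours of it, but it has only one, namely the vertex to which it was attached. So the
  cycle visits that vertex twice unless it just walks to it and back.
\<close>

lemma no_cycle:
  assumes "pre_digraph.cycle (with_proj G) p" "3 \<le> length p"
  shows False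
proof -
  interpret pair_graph G by (rule pair_graph)
  obtain u where p: "set p \<subseteq> parcs G" "pcas u p u" "distinct (map snd p)"
    using assms(1) by (auto simp: cycle_def awalk_def pawalk_verts_eq_heads)
  define I where "I = {i. i < n \<and> w i \<in> snd ` set p}"
  have "finite I"
    by (simp add: I_def)
  moreover have "I \<noteq> {}"
  proof -
    have "hd p \<in> set p"
      using assms(2) by (cases p) auto
    then have "snd (hd p) \<in> pverts G" "snd (hd p) \<in> snd ` set p"
      using p(1) arc_snd_in_verts by auto
    then obtain i where "i < n" "snd (hd p) = w i"
      by (auto simp: pverts_eq)
    then have "i \<in> I"
      using \<open>snd (hd p) \<in> snd ` set p\<close> unfolding I_def by simp
    then show ?thesis
      by blast
  qed
  ultimately have Max_I: "Max I \<in> I" "\<And>i. i \<in> I \<Longrightarrow> i \<le> Max I"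
    by simp_all
  define m where "m = Max I"
  have m: "m < n" and "w m \<in> snd ` set p"
    using Max_I(1) by (auto simp: I_def m_def)
  then obtain e where e: "e \<in> set p" "snd e = w m"
    by auto
  obtain p1 p2 where p_split: "p = p1 @ e # p2"
    using split_list[OF e(1)] by auto
  define r where "r = p2 @ p1 @ [e]"
  have r: "set r = set p" "distinct (map snd r)" "length r = length p"
    using p(3) by (auto simp: r_def p_split)
  have "pcas (w m) r (w m)"
    using p(2) e(2) by (auto simp: r_def p_split pcas_append simp del: cas_append_iff)
  moreover obtain e1 s where r_eq: "r = e1 # s @ [e]" and "s \<noteq> []"
  proof -
    have "2 \<le> length (p2 @ p1)"
      using assms(2) by (simp add: p_split)
    then obtain e1 t where "p2 @ p1 = e1 # t" "t \<noteq> []"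
      by (cases "p2 @ p1") (force simp del: length_append)+
    then show thesis
      using that[of e1 t] by (simp add: r_def)
  qed
  ultimately have walk: "fst e1 = w m" "pcas (snd e1) s (fst e)"
    by (auto simp: pcas_append)
  then have "snd (last s) = fst e"
    using \<open>s \<noteq> []\<close> by (induction s rule: rev_induct) (auto simp: pcas_append)
  have last_s: "last s \<in> set s"
    using \<open>s \<noteq> []\<close> by simp
  have older: "x = w (q m)"
    if x: "x \<in> snd ` set p" and arc: "(w m, x) \<in> parcs G \<or> (x, w m) \<in> parcs G" for x
  proof -
    have "x \<in> pverts G"
      using arc in_arcsD1 in_arcsD2 by blast
    then obtain i where i: "i < n" "x = w i"
      by (auto simp: pverts_eq)
    then have arc_cases: "0 < m \<and> i = q m \<or> 0 < i \<and> m = q i"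
      using arc m by (auto simp: arc_iff)
    have "i \<le> m"
      using i x Max_I(2) by (simp add: I_def m_def)
    then show ?thesis
      using i arc_cases parent_less[of i] by auto
  qed
  have sub: "set r \<subseteq> parcs G"
    using p(1) r(1) by simp
  have "snd e1 = w (q m)"
  proof (rule older)
    show "snd e1 \<in> snd ` set p"
      unfolding r(1)[symmetric] by (simp add: r_eq)
    show "(w m, snd e1) \<in> parcs G \<or> (snd e1, w m) \<in> parcs G"
      using sub walk(1) by (cases e1) (auto simp: r_eq)
  qed
  moreover have "fst e = w (q m)"
  proof (rule older)
    show "fst e \<in> snd ` set p"
      unfolding r(1)[symmetric] \<open>snd (last s) = fst e\<close>[symmetric]
      using last_s by (auto simp: r_eq)
    show "(w m, fst e) \<in> parcs G \<or> (fst e, w m) \<in> parcs G"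
      using sub e(2) by (cases e) (auto simp: r_eq)
  qed
  ultimately have "snd e1 \<in> snd ` set s"
    using last_s \<open>snd (last s) = fst e\<close> by force
  then show False
    using r(2) by (auto simp: r_eq)
qed

lemma undirected_tree: "undirected_tree G"
  unfolding undirected_tree_def using pair_graph connected no_cycle by blast

lemma leaf_if_childless:
  assumes "0 < i" "i < n" and childless: "\<And>j. 0 < j \<Longrightarrow> j < n \<Longrightarrow> q j \<noteq> i"
  shows "leaf G (w i)"
proof -
  have "q i < n"
    using parent_less[of i] assms by simp
  have "out_arcs (with_proj G) (w i) = {(w i, w (q i))}"
  proof -
    have only: "y = w (q i)" if "(w i, y) \<in> parcs G" for y
      using that
    proof (rule arcE)
      fix k j
      assume "k < n" "j < n" "w i = w k" "y = w j" "0 < k \<and> j = q k \<or> 0 < j \<and> k = q j"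
      then show ?thesis
        using assms(2) childless[of j] by (auto simp: w_eq_iff)
    qed
    have "(w i, w (q i)) \<in> parcs G"
      using assms \<open>q i < n\<close> by (simp add: arc_iff)
    then show ?thesis
      by (auto simp: out_arcs_def dest: only)
  qed
  then show ?thesis
    using assms by (auto simp: leaf_def out_degree_def pverts_eq)
qed

end

lemma successively_remdups_adj:
  "successively (\<lambda>x y. x = y \<or> P x y) xs \<Longrightarrow> successively P (remdups_adj xs)"
  by (induction xs rule: remdups_adj.induct) (auto simp: successively_Cons)

lemma vwalk_arcs_subset_if_successively:
  "successively (\<lambda>x y. (x, y) \<in> E) xs \<Longrightarrow> set (vwalk_arcs xs) \<subseteq> E"
  by (induction xs rule: vwalk_arcs.induct) auto

text \<open>
  The spine lists the vertices to which something is attached, in the order of attachment.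
  When the attachment point changes, it moves to the vertex just added, whose neighbour
  is the previous attachment point; so the list is a walk, and its indices increase.
\<close>

lemma (in recursive_tree) caterpillar:
  assumes step: "\<And>j. 0 < j \<Longrightarrow> Suc j < n \<Longrightarrow> q (Suc j) = q j \<or> q (Suc j) = j"
  shows "caterpillar G"
proof (cases "n = 1")
  case True
  have "vpath [w 0] (with_proj G)"
    using n_pos by (auto simp: vpath_def vwalk_def pverts_eq)
  moreover have "{v \<in> pverts G. \<not> leaf G v} \<subseteq> set [w 0]"
    using True by (auto simp: pverts_eq)
  ultimately show ?thesis
    unfolding caterpillar_def using undirected_tree by blast
next
  case False
  define P where "P = (\<lambda>i j. 0 < j \<and> j < n \<and> i = q j)"
  define ps where "ps = remdups_adj (map q [1..<n])"
  have set_ps: "set ps = q ` {0<..<n}"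
    by (auto simp: ps_def)
  have less_n: "i < n" if "i \<in> set ps" for i
  proof -
    obtain j where "0 < j" "j < n" "i = q j"
      using \<open>i \<in> set ps\<close> by (auto simp: set_ps)
    then show ?thesis
      using parent_less[of j] by simp
  qed
  have "successively (\<lambda>i j. i = j \<or> P i j) (map q [1..<n])"
  proof -
    have "q i = q (Suc i) \<or> P (q i) (q (Suc i))" if "0 < i" "Suc i < n" for i
      using step[OF that] that by (auto simp: P_def)
    then show ?thesis
      by (auto simp: successively_conv_nth)
  qed
  then have succ_P: "successively P ps"
    unfolding ps_def by (rule successively_remdups_adj)
  then have "successively (<) ps"
    by (rule successively_mono) (use parent_less in \<open>auto simp: P_def\<close>)
  then have "distinct ps"
    by (simp add: successively_conv_sorted_wrt strict_sorted_iff)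
  have "vpath (map w ps) (with_proj G)"
  proof (intro vpathI vwalkI)
    show "set (map w ps) \<subseteq> verts (with_proj G)"
      using less_n by (auto simp: pverts_eq)
    have "successively (\<lambda>i j. (w i, w j) \<in> parcs G) ps"
      using succ_P by (rule successively_mono) (auto simp: P_def parcs_eq)
    then show "set (vwalk_arcs (map w ps)) \<subseteq> arcs_ends (with_proj G)"
      by (simp add: vwalk_arcs_subset_if_successively successively_map)
    show "map w ps \<noteq> []"
      using False n_pos by (simp add: ps_def)
    show "distinct (map w ps)"
      using \<open>distinct ps\<close> less_n by (auto simp: distinct_map inj_on_def w_eq_iff)
  qed
  moreover have "v \<in> set (map w ps)" if v: "v \<in> pverts G" "\<not> leaf G v" for v
  proof -
    obtain i where i: "i < n" "v = w i"
      using v(1) by (auto simp: pverts_eq)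
    have "i \<in> set ps"
    proof (cases "i = 0")
      case True
      have "q 1 = 0"
        using parent_less[of 1] \<open>n \<noteq> 1\<close> n_pos by simp
      moreover have "1 \<in> {0<..<n}"
        using \<open>n \<noteq> 1\<close> n_pos by simp
      ultimately show ?thesis
        unfolding set_ps True by (metis imageI)
    next
      case False
      then show ?thesis
        using leaf_if_childless[of i] i v(2) unfolding set_ps
        by (metis greaterThanLessThan_iff gr0I imageI)
    qed
    then show ?thesis
      using i by simp
  qed
  ultimately show ?thesis
    unfolding caterpillar_def using undirected_tree by blast
qed

section \<open>Permutations with two laced tilings\<close>

text \<open>
  \<open>A\<close> is the set of ascents. The intervals \<open>[a, \<pi> a]\<close> for \<open>a \<in> A\<close> tile \<open>[1, n]\<close>, and so do the
  intervals \<open>[\<pi> d, d]\<close> for the other positions \<open>d\<close>.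
\<close>

locale laced_permutation =
  fixes n :: nat and \<pi> :: "nat \<Rightarrow> nat" and A :: "nat set"
  assumes n_ge_2: "2 \<le> n"
    and perm: "\<pi> permutes {1..n}"
    and A_subset: "A \<subseteq> {1..n}"
    and ascent: "a \<in> A \<Longrightarrow> a < \<pi> a"
    and ascent_target: "a \<in> A \<Longrightarrow> \<pi> a \<in> A \<or> \<pi> a = n"
    and ascent_next: "a \<in> A \<Longrightarrow> x \<in> A \<Longrightarrow> a < x \<Longrightarrow> \<pi> a \<le> x"
    and descent: "d \<in> {1..n} - A \<Longrightarrow> \<pi> d < d"
    and descent_target: "d \<in> {1..n} - A \<Longrightarrow> \<pi> d \<notin> A \<or> \<pi> d = 1"
    and descent_next: "d \<in> {1..n} - A \<Longrightarrow> y \<in> {1..n} - A \<Longrightarrow> y < d \<Longrightarrow> y \<le> \<pi> d"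
begin

lemma \<pi>_range: "\<pi> i \<in> {1..n} \<longleftrightarrow> i \<in> {1..n}"
  using perm by (rule permutes_in_image)

lemma inv_\<pi>: "inv \<pi> (\<pi> i) = i"
  using perm by (simp add: permutes_inverses)

lemma zero_notin_A: "0 \<notin> A"
  using A_subset by auto

lemma one_in_A: "1 \<in> A"
proof (rule ccontr)
  assume "1 \<notin> A"
  then have "\<pi> 1 < 1"
    using n_ge_2 by (intro descent) simp
  then show False
    using \<pi>_range[of 1] n_ge_2 by simp
qed

lemma n_notin_A: "n \<notin> A"
proof
  assume "n \<in> A"
  then have "n < \<pi> n"
    by (rule ascent)
  then show False
    using \<pi>_range[of n] n_ge_2 by simp
qed

lemma A_less_n: "a \<in> A \<Longrightarrow> a < n"
  using A_subset n_notin_A by (cases "a = n") (auto dest!: subsetD)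

text \<open>
  A value stands for the interval of which it is the image: \<open>\<pi> a\<close> for \<open>[a, \<pi> a]\<close> and \<open>\<pi> d\<close> for
  \<open>[\<pi> d, d]\<close>. Both are attached when the left end is passed. The two intervals that start
  at \<open>1\<close> get the times \<open>0\<close> and \<open>1\<close>.
\<close>

definition vertex :: "nat \<Rightarrow> nat" where
  "vertex j = (if j = 0 then 1 else if j \<in> A then \<pi> j else j)"

text \<open>
  The time of the last attached interval of the other tiling. Since \<open>0 \<notin> A\<close>, time \<open>0\<close> counts as
  a non-ascent, as it should: it stands for the interval \<open>[1, d]\<close> with \<open>\<pi> d = 1\<close>.
\<close>

definition parent :: "nat \<Rightarrow> nat" where
  "parent j = Max {i. i < j \<and> (i \<in> A) \<noteq> (j \<in> A)}"

lemma parent_eq_iff: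
  assumes "0 < j"
  shows "i = parent j \<longleftrightarrow>
    i < j \<and> (i \<in> A) \<noteq> (j \<in> A) \<and> (\<forall>k. i < k \<and> k < j \<longrightarrow> (k \<in> A) = (j \<in> A))"
proof -
  let ?S = "{i. i < j \<and> (i \<in> A) \<noteq> (j \<in> A)}"
  have "?S \<noteq> {}"
  proof (cases "j \<in> A")
    case True
    then have "0 \<in> ?S"
      using assms zero_notin_A by simp
    then show ?thesis
      by blast
  next
    case False
    then have "1 \<in> ?S"
      using assms one_in_A by (cases "j = 1") auto
    then show ?thesis
      by blast
  qed
  then have "i = parent j \<longleftrightarrow> i \<in> ?S \<and> (\<forall>k\<in>?S. k \<le> i)"
    unfolding parent_def by (subst eq_commute, intro Max_eq_iff) auto
  then show ?thesis
    by (auto simp: not_less[symmetric])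
qed

lemmas parentD = parent_eq_iff[THEN iffD1, OF _ refl]

lemma parent_Suc: "0 < j \<Longrightarrow> parent (Suc j) = parent j \<or> parent (Suc j) = j"
proof (cases "(Suc j \<in> A) = (j \<in> A)")
  case True
  assume "0 < j"
  then have "parent j = parent (Suc j)"
    using True parentD[of j] by (auto simp: parent_eq_iff less_Suc_eq)
  then show ?thesis
    by simp
next
  case False
  then have "j = parent (Suc j)"
    by (auto simp: parent_eq_iff)
  then show ?thesis
    by simp
qed

lemma bij_betw_vertex: "bij_betw vertex {..<n} {1..n}"
proof -
  have "vertex j \<in> {1..n}" if "j < n" for j
    using that \<pi>_range[of j] n_ge_2 by (auto simp: vertex_def)
  moreover have "y \<in> vertex ` {..<n}" if y: "y \<in> {1..n}" for y
  proof -
    obtain i where i: "y = \<pi> i" "i \<in> {1..n}"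
      using y permutes_image[OF perm] by blast
    show ?thesis
    proof (cases "i \<in> A")
      case True
      then show ?thesis
        using i A_less_n by (force simp: vertex_def)
    next
      case False
      then have "y < n" "y \<notin> A \<or> y = 1"
        using i descent[of i] descent_target[of i] by auto
      then have "y = vertex 0 \<or> y = vertex y"
        using y by (auto simp: vertex_def)
      then show ?thesis
        using \<open>y < n\<close> n_ge_2 by force
    qed
  qed
  ultimately have "vertex ` {..<n} = {1..n}"
    by blast
  moreover from this have "inj_on vertex {..<n}"
    by (intro eq_card_imp_inj_on) simp_all
  ultimately show ?thesis
    by (simp add: bij_betw_def)
qed

text \<open>
  \<open>\<pi>\<close> is increasing on each of the two kinds of positions, and a descent followed by an ascent
  cannot be inverted because it moves left and the ascent moves right.
\<close>

lemma inverted_positions: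
  assumes "i \<in> {1..n}" "j \<in> {1..n}" "i < j" "\<pi> j < \<pi> i"
  shows "i \<in> A \<and> j \<notin> A"
proof (cases "i \<in> A"; cases "j \<in> A")
  assume "i \<in> A" "j \<in> A"
  then show ?thesis
    using ascent_next[of i j] ascent[of j] assms by simp
next
  assume "i \<notin> A" "j \<notin> A"
  then show ?thesis
    using descent_next[of j i] descent[of i] assms by simp
next
  assume "i \<notin> A" "j \<in> A"
  then show ?thesis
    using descent[of i] ascent[of j] assms by simp
qed blast

text \<open>
  \<open>a < d\<close> and \<open>\<pi> d < \<pi> a\<close> say that the interiors of \<open>[a, \<pi> a]\<close> and \<open>[\<pi> d, d]\<close> meet. Then the later
  of the two left ends lies in the other interval, which is the only one of its tiling
  that is open there, so it is the one that starts last.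
\<close>

lemma inversion_iff_parent:
  assumes a: "a \<in> A" and d: "d \<in> {1..n} - A"
    and b: "b = (if \<pi> d = 1 then 0 else \<pi> d)"
  shows "a < d \<and> \<pi> d < \<pi> a \<longleftrightarrow> b = parent a \<or> 0 < b \<and> a = parent b"
proof -
  have "0 < a" "a < n"
    using a A_less_n zero_notin_A by (auto intro: gr0I)
  have "\<pi> d < d" "1 \<le> \<pi> d"
    using descent[OF d] \<pi>_range[of d] d by auto
  have "b \<notin> A" "b \<le> \<pi> d" "b < n"
    using descent_target[OF d] \<open>\<pi> d < d\<close> d zero_notin_A by (auto simp: b)
  have right: "x \<in> A" if "b < x" "x < d" for x
  proof (rule ccontr)
    assume "x \<notin> A"
    then have "x \<le> \<pi> d"
      using descent_next[OF d, of x] that d by auto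
    then have "\<pi> d = 1" "x = 1"
      using that \<open>1 \<le> \<pi> d\<close> by (auto simp: b split: if_splits)
    then show False
      using \<open>x \<notin> A\<close> one_in_A by simp
  qed
  have left: "x \<notin> A" if "a < x" "x < \<pi> a" for x
    using ascent_next[OF a, of x] that by auto
  show ?thesis
  proof
    assume inv: "a < d \<and> \<pi> d < \<pi> a"
    show "b = parent a \<or> 0 < b \<and> a = parent b"
    proof (cases "b < a")
      case True
      then have "b = parent a"
        using right inv a \<open>0 < a\<close> \<open>b \<notin> A\<close> by (auto simp: parent_eq_iff)
      then show ?thesis ..
    next
      case False
      then have "a < b"
        using a \<open>b \<notin> A\<close> by (cases "a = b") auto
      then have "a = parent b"
        using left inv a \<open>b \<notin> A\<close> \<open>b \<le> \<pi> d\<close> by (auto simp: parent_eq_iff)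
      then show ?thesis
        using \<open>a < b\<close> by simp
    qed
  next
    assume "b = parent a \<or> 0 < b \<and> a = parent b"
    then show "a < d \<and> \<pi> d < \<pi> a"
    proof
      assume "b = parent a"
      then have "b < a" and between: "\<And>k. b < k \<Longrightarrow> k < a \<Longrightarrow> k \<in> A"
        using a parent_eq_iff[OF \<open>0 < a\<close>, of b] by blast+
      then have "\<pi> d \<le> a"
        using \<open>0 < a\<close> by (auto simp: b split: if_splits)
      moreover have "a < d"
      proof (rule ccontr)
        assume "\<not> a < d"
        then have "d \<in> A"
          using between[of d] a \<open>b \<le> \<pi> d\<close> \<open>\<pi> d < d\<close> by (cases "d = a") auto
        then show False
          using d by simp
      qed
      ultimately show ?thesis
        using ascent[OF a] by simp
    next
      assume "0 < b \<and> a = parent b"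
      then have "a < b" and between: "\<And>k. a < k \<Longrightarrow> k < b \<Longrightarrow> k \<notin> A"
        using \<open>b \<notin> A\<close> parent_eq_iff[of b a] by blast+
      moreover have "\<pi> d = b"
        using \<open>a < b\<close> by (simp add: b split: if_splits)
      moreover have "b < \<pi> a"
      proof (rule ccontr)
        assume "\<not> b < \<pi> a"
        then have "\<pi> a \<notin> A"
          using between[of "\<pi> a"] ascent[OF a] \<open>b \<notin> A\<close> by (cases "\<pi> a = b") auto
        then show False
          using ascent_target[OF a] \<open>b < n\<close> \<open>\<not> b < \<pi> a\<close> by simp
      qed
      ultimately show ?thesis
        using \<open>\<pi> d < d\<close> by simp
    qed
  qed
qed

lemma parcs_inversion_graph:
  "parcs (inversion_graph n \<pi>) =
    (\<Union>j\<in>{0<..<n}. {(vertex j, vertex (parent j)), (vertex (parent j), vertex j)})"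
  (is "?E = ?F")
proof -
  have E_iff: "(\<pi> i, \<pi> j) \<in> ?E \<longleftrightarrow>
      i \<in> {1..n} \<and> j \<in> {1..n} \<and> (i < j \<and> \<pi> j < \<pi> i \<or> j < i \<and> \<pi> i < \<pi> j)" for i j
    unfolding inversion_graph_def using \<pi>_range[of i] \<pi>_range[of j] by (auto simp: inv_\<pi>)
  have F_if_inverted: "(\<pi> i, \<pi> j) \<in> ?F \<and> (\<pi> j, \<pi> i) \<in> ?F"
    if ij: "i \<in> {1..n}" "j \<in> {1..n}" "i < j" "\<pi> j < \<pi> i" for i j
  proof -
    have i: "i \<in> A" and j: "j \<in> {1..n} - A"
      using inverted_positions[OF ij] ij by auto
    define b where "b = (if \<pi> j = 1 then 0 else \<pi> j)"
    have "\<pi> i = vertex i"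
      using ij i by (auto simp: vertex_def)
    moreover have "\<pi> j = vertex b"
      using descent_target[OF j] \<pi>_range[of j] j by (auto simp: vertex_def b_def)
    moreover have "b < n"
      using descent[OF j] j by (auto simp: b_def)
    moreover have "0 < i" "i < n"
      using ij A_less_n[OF i] by auto
    moreover have "b = parent i \<or> 0 < b \<and> i = parent b"
      using inversion_iff_parent[OF i j b_def] ij by simp
    ultimately show ?thesis
      by auto
  qed
  have E_if_parent: "(vertex a, vertex b) \<in> ?E \<and> (vertex b, vertex a) \<in> ?E"
    if a: "a \<in> A" and b: "b \<notin> A" "b < n" and ab: "b = parent a \<or> 0 < b \<and> a = parent b" for a b
  proof -
    have "vertex b \<in> {1..n}"
      using bij_betw_vertex b by (auto simp: bij_betw_def)
    then obtain d where d: "vertex b = \<pi> d" "d \<in> {1..n}"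
      using permutes_image[OF perm] by blast
    \<comment> \<open>An ascent goes to \<open>n\<close> or an ascent other than \<open>1\<close>, so never to \<open>vertex b\<close>.\<close>
    have "d \<notin> A"
    proof
      assume "d \<in> A"
      then have "d < vertex b" "vertex b \<in> A \<or> vertex b = n"
        using ascent[of d] ascent_target[of d] d by auto
      then show False
        using b d n_ge_2 by (auto simp: vertex_def split: if_splits)
    qed
    moreover have "b = (if \<pi> d = 1 then 0 else \<pi> d)"
      using b one_in_A d(1) by (auto simp: vertex_def split: if_splits)
    ultimately have "a < d" "\<pi> d < \<pi> a"
      using inversion_iff_parent[OF a, of d b] ab d by auto
    moreover have "vertex a = \<pi> a" "a \<in> {1..n}"
      using a zero_notin_A A_subset by (auto simp: vertex_def)
    ultimately show ?thesis
      using d by (simp add: E_iff)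
  qed
  show ?thesis
  proof (intro equalityI subrelI)
    fix x y
    assume xy: "(x, y) \<in> ?E"
    then have "x \<in> {1..n}" "y \<in> {1..n}"
      by (auto simp: inversion_graph_def)
    then obtain i j where "x = \<pi> i" "y = \<pi> j"
      using permutes_image[OF perm] by blast
    then show "(x, y) \<in> ?F"
      using xy F_if_inverted unfolding \<open>x = \<pi> i\<close> \<open>y = \<pi> j\<close> E_iff by blast
  next
    fix x y
    assume "(x, y) \<in> ?F"
    then obtain j where j: "0 < j" "j < n"
      and xy: "(x, y) = (vertex j, vertex (parent j)) \<or> (x, y) = (vertex (parent j), vertex j)"
      by auto
    have "parent j < n" "(parent j \<in> A) \<noteq> (j \<in> A)"
      using parentD[OF j(1)] j by auto
    then show "(x, y) \<in> ?E"
      using E_if_parent[of j "parent j"] E_if_parent[of "parent j" j] j xy by auto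
  qed
qed

lemma caterpillar_inversion_graph: "caterpillar (inversion_graph n \<pi>)"
proof -
  interpret recursive_tree "inversion_graph n \<pi>" vertex parent n
  proof
    show "0 < n"
      using n_ge_2 by simp
    show "bij_betw vertex {..<n} (pverts (inversion_graph n \<pi>))"
      using bij_betw_vertex by (simp add: inversion_graph_def)
    show "parent j < j" if "0 < j" for j
      using parentD[OF that] by simp
  qed (rule parcs_inversion_graph)
  show ?thesis
    by (rule caterpillar) (rule parent_Suc)
qed

end

section \<open>Unimodal cycles\<close>

lemma map_cycle_of_list_rotate:
  assumes "distinct cs"
  shows "map (cycle_of_list cs) (rotate k cs) = rotate1 (rotate k cs)"
proof -
  have "map (cycle_of_list cs) cs = rotate1 cs"
    using cyclic_rotation[OF assms, of 1] by simp
  then show ?thesis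
    by (simp add: rotate_map[symmetric] rotate1_rotate_swap)
qed

text \<open>
  The minimum of a unimodal list is at one of its ends, so after at most one further rotation
  it comes first.
\<close>

lemma unimodal_cycle_branches:
  assumes "unimodal_cycle n \<pi>" "2 \<le> n"
  obtains us ds where "set us \<union> set ds \<union> {1, n} = {1..n}"
    "sorted_wrt (<) (1 # us @ [n])" "map \<pi> (1 # us) = us @ [n]"
    "sorted_wrt (>) (n # ds @ [1])" "map \<pi> (n # ds) = ds @ [1]"
proof -
  obtain cs k where cs: "distinct cs" "set cs = {1..n}" "\<pi> = cycle_of_list cs"
    "unimodal (rotate k cs)"
    using assms(1) by (auto simp: unimodal_cycle_def)
  obtain us m ds where split: "rotate k cs = us @ m # ds"
    and up: "sorted_wrt (<) (us @ [m])" and down: "sorted_wrt (>) (m # ds)"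
    using cs(4) by (auto simp: unimodal_def)
  have map: "map \<pi> (us @ m # ds) = rotate1 (us @ m # ds)"
    using map_cycle_of_list_rotate[OF cs(1), of k] by (simp add: cs(3) split)
  have set: "set us \<union> {m} \<union> set ds = {1..n}"
    using cs(2) set_rotate[of k cs] by (auto simp: split)
  have dist: "distinct (us @ m # ds)"
    using cs(1) distinct_rotate[of k cs] by (simp add: split)
  have le_m: "x \<le> m" if "x \<in> {1..n}" for x
    using that up down set by (auto simp: sorted_wrt_append less_imp_le)
  have "m = n"
  proof (rule antisym)
    show "n \<le> m"
      using le_m[of n] assms(2) by simp
    have "m \<in> {1..n}"
      using set by blast
    then show "m \<le> n"
      by simp
  qed
  have ge_1: "1 \<le> x" if "x \<in> set us \<union> set ds" for x
    using that set by auto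
  have "1 \<in> set us \<or> 1 \<in> set ds"
  proof -
    have "1 \<in> set us \<union> {m} \<union> set ds"
      unfolding set using assms(2) by simp
    then show ?thesis
      using assms(2) \<open>m = n\<close> by auto
  qed
  then show thesis
  proof
    assume "1 \<in> set us"
    then obtain us' where us: "us = 1 # us'"
      using up ge_1 by (cases us) (force simp: sorted_wrt_append)+
    show thesis
    proof (rule that[of us' ds])
      show "set us' \<union> set ds \<union> {1, n} = {1..n}"
        using set by (auto simp: us \<open>m = n\<close>)
      show "sorted_wrt (<) (1 # us' @ [n])"
        using up by (simp add: us \<open>m = n\<close>)
      have "map \<pi> (1 # us') @ map \<pi> (n # ds) = (us' @ [n]) @ (ds @ [1])"
        using map by (simp add: us \<open>m = n\<close>)
      then show "map \<pi> (1 # us') = us' @ [n]" "map \<pi> (n # ds) = ds @ [1]"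
        by (subst (asm) append_eq_append_conv; simp)+
      have "1 < x" if "x \<in> set ds" for x
        using that ge_1[of x] dist by (auto simp: us order_le_less)
      then show "sorted_wrt (>) (n # ds @ [1])"
        using down assms(2) by (auto simp: sorted_wrt_append \<open>m = n\<close>)
    qed
  next
    assume "1 \<in> set ds"
    then obtain ds' where ds: "ds = ds' @ [1]"
      using down ge_1 by (cases ds rule: rev_cases) (force simp: sorted_wrt_append)+
    show thesis
    proof (rule that[of us ds'])
      show "set us \<union> set ds' \<union> {1, n} = {1..n}"
        using set by (auto simp: ds \<open>m = n\<close>)
      show "sorted_wrt (>) (n # ds' @ [1])"
        using down by (simp add: ds \<open>m = n\<close>)
      have "1 < x" if "x \<in> set us" for x
        using that ge_1[of x] dist by (auto simp: ds order_le_less)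
      then show "sorted_wrt (<) (1 # us @ [n])"
        using up assms(2) by (auto simp: sorted_wrt_append \<open>m = n\<close>)
      have "map \<pi> (1 # us) = us @ [n] \<and> map \<pi> (n # ds') = ds' @ [1]"
      proof (cases us)
        case Nil
        then show ?thesis
          using map by (simp add: ds \<open>m = n\<close>)
      next
        case (Cons u us')
        have "map \<pi> us @ map \<pi> (n # ds') @ [\<pi> 1] = (us' @ [n]) @ (ds' @ [1]) @ [u]"
          using map by (simp add: Cons ds \<open>m = n\<close>)
        then have "map \<pi> us = us' @ [n]" "map \<pi> (n # ds') @ [\<pi> 1] = (ds' @ [1]) @ [u]"
          by (subst (asm) append_eq_append_conv; simp add: Cons)+
        then show ?thesis
          by (simp add: Cons)
      qed
      then show "map \<pi> (1 # us) = us @ [n]" "map \<pi> (n # ds') = ds' @ [1]"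
        by blast+
    qed
  qed
qed

text \<open>Shared by the two branches: \<open>R\<close> is \<open><\<close> for one and \<open>>\<close> for the other.\<close>

lemma successor_in_sorted_list:
  assumes "sorted_wrt R (x # xs @ [b])" "map f (x # xs) = xs @ [b]"
    "asymp R" "z \<in> set (x # xs)"
  shows "R z (f z)" "f z \<in> set (xs @ [b])"
    "\<And>y. y \<in> set (x # xs) \<Longrightarrow> R z y \<Longrightarrow> y = f z \<or> R (f z) y"
proof -
  have "R z (f z) \<and> f z \<in> set (xs @ [b]) \<and>
    (\<forall>y\<in>set (x # xs). R z y \<longrightarrow> y = f z \<or> R (f z) y)"
    using assms
  proof (induction xs arbitrary: x)
    case Nil
    then show ?case
      by (auto dest: asympD)
  next
    case (Cons x' xs)
    then show ?case
      by (auto dest: asympD)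
  qed
  then show "R z (f z)" "f z \<in> set (xs @ [b])"
    "\<And>y. y \<in> set (x # xs) \<Longrightarrow> R z y \<Longrightarrow> y = f z \<or> R (f z) y"
    by blast+
qed

lemma unimodal_cycle_laced:
  assumes "unimodal_cycle n \<pi>" "2 \<le> n" "\<pi> permutes {1..n}"
  shows "laced_permutation n \<pi> {a \<in> {1..n}. a < \<pi> a}"
proof -
  obtain us ds where set: "set us \<union> set ds \<union> {1, n} = {1..n}"
    and up: "sorted_wrt (<) (1 # us @ [n])" "map \<pi> (1 # us) = us @ [n]"
    and down: "sorted_wrt (>) (n # ds @ [1])" "map \<pi> (n # ds) = ds @ [1]"
    using unimodal_cycle_branches[OF assms(1,2)] .
  have "asymp ((<) :: nat \<Rightarrow> nat \<Rightarrow> bool)" "asymp ((>) :: nat \<Rightarrow> nat \<Rightarrow> bool)"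
    by (simp_all add: asymp_on_less asymp_on_greater)
  note up' = successor_in_sorted_list[OF up this(1)]
    and down' = successor_in_sorted_list[OF down this(2)]
  have set_eq: "{1..n} = set (1 # us) \<union> set (n # ds)"
    using set by auto
  have ascent: "a < \<pi> a" if "a \<in> set (1 # us)" for a
    using up'(1)[OF that] .
  have descent: "\<pi> d < d" if "d \<in> set (n # ds)" for d
    using down'(1)[OF that] .
  have disjoint: "set (1 # us) \<inter> set (n # ds) = {}"
    using ascent descent less_asym by blast
  have A: "{a \<in> {1..n}. a < \<pi> a} = set (1 # us)"
    unfolding set_eq using ascent descent less_asym by blast
  then have D: "{1..n} - {a \<in> {1..n}. a < \<pi> a} = set (n # ds)"
    using disjoint set_eq by blast
  show ?thesis
  proof (unfold_locales, unfold D, unfold A)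
    show "set (1 # us) \<subseteq> {1..n}"
      using A by blast
    show "\<pi> a \<in> set (1 # us) \<or> \<pi> a = n" if "a \<in> set (1 # us)" for a
      using up'(2)[OF that] by auto
    show "\<pi> a \<le> x" if "a \<in> set (1 # us)" "x \<in> set (1 # us)" "a < x" for a x
      using up'(3)[OF that] by auto
    show "\<pi> d \<notin> set (1 # us) \<or> \<pi> d = 1" if "d \<in> set (n # ds)" for d
      using down'(2)[OF that] disjoint by auto
    show "y \<le> \<pi> d" if "d \<in> set (n # ds)" "y \<in> set (n # ds)" "y < d" for d y
      using down'(3)[OF that] by auto
  qed (use assms ascent descent in blast)+
qed

theorem proposition5p4:
  fixes n :: nat and \<pi> :: "nat \<Rightarrow> nat"
  assumes "1 \<le> n"
    and "\<pi> permutes {1..n}"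
    and "unimodal_cycle n \<pi>"
  shows "caterpillar (inversion_graph n \<pi>)"
proof (cases "n = 1")
  case True
  \<comment> \<open>A single vertex, to which nothing is attached.\<close>
  interpret recursive_tree "inversion_graph n \<pi>" "\<lambda>_. 1" "\<lambda>_. 0" n
    using True by unfold_locales (auto simp: inversion_graph_def bij_betw_def lessThan_Suc)
  show ?thesis
    by (rule caterpillar) simp
next
  case False
  then interpret laced_permutation n \<pi> "{a \<in> {1..n}. a < \<pi> a}"
    using assms by (intro unimodal_cycle_laced) auto
  show ?thesis
    by (rule caterpillar_inversion_graph)
qed

end
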